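(* Let $\kappa$ be a field, $G$ a group and $\sigma\in pm(G)$. For any partial $\sigma$-representation $\Gamma$ of $G$ into a unital $\kappa$-algebra $R$ there exists a unique $\kappa$-algebra homomorphism $\tilde\Gamma:\kappa_{par}^\sigma G\to R$ such that $$\tilde\Gamma\circ[\cdot]^\sigma=\Gamma .$$ Conversely, any $\kappa$-algebra homomorphism $\tilde\Gamma:\kappa_{par}^\sigma G\to R$ gives rise to a partial $\sigma$-representation $\Gamma:G\to R$ such that $\tilde\Gamma\circ[\cdot]^\sigma=\Gamma$.
   Context: Algebras are associative and unital with $1\neq0$, and algebra homomorphisms preserve the unit. Let $\sigma:G\times G\to\kappa$ be a function. For a map $\Gamma:G\to R$ into a unital $\kappa$-algebra consider the conditions, for all $g,h\in G$: (1) $\sigma(g,h)=0$ implies $\Gamma(g^{-1})\Gamma(gh)=0$ and $\Gamma(gh)\Gamma(h^{-1})=0$; (2) $\Gamma(g^{-1})\Gamma(g)\Gamma(h)=\sigma(g,h)\Gamma(g^{-1})\Gamma(gh)$; (3) $\Gamma(g)\Gamma(h)\Gamma(h^{-1})=\sigma(g,h)\Gamma(gh)\Gamma(h^{-1})$; (4) $\Gamma(1_G)=1_R$. If (1)--(4) hold for some $\sigma$, $\Gamma$ is a partial projective representation; if moreover $\Gamma(g)\Gamma(h)=0$ implies $\sigma(g,h)=0$, then $\sigma$ is called a factor set of $\Gamma$. $pm(G)$ is the set of all factor sets of partial projective representations of $G$ in unital $\kappa$-algebras. For $\sigma\in pm(G)$, a partial $\sigma$-representation of $G$ in $R$ is a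 map $\Gamma:G\to R$ satisfying (1)--(4) with this $\sigma$ (it is not required that $\sigma$ be the factor set of $\Gamma$). The twisted partial group algebra $\kappa_{par}^\sigma G$ is the universal unital $\kappa$-algebra generated by symbols $[g]^\sigma$ ($g\in G$) subject to: $[g^{-1}]^\sigma[gh]^\sigma=[gh]^\sigma[h^{-1}]^\sigma=0$ whenever $\sigma(g,h)=0$; $[g^{-1}]^\sigma[g]^\sigma[h]^\sigma=\sigma(g,h)[g^{-1}]^\sigma[gh]^\sigma$; $[g]^\sigma[h]^\sigma[h^{-1}]^\sigma=\sigma(g,h)[gh]^\sigma[h^{-1}]^\sigma$; $[g]^\sigma[1_G]^\sigma=[1_G]^\sigma[g]^\sigma=[g]^\sigma$ (so $[1_G]^\sigma=1$). The map $[\cdot]^\sigma:G\to\kappa_{par}^\sigma G$ is $g\mapsto[g]^\sigma$. *)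

theory Defs
  imports "HOL-Algebra.QuotRing" "HOL-Algebra.Module"
begin

text \<open>
  Associative unital algebras with \<open>1 \<noteq> 0\<close> over a field.  The library locale \<^locale>\<open>algebra\<close>
  is not usable here because it requires the algebra itself to be commutative.
\<close>

locale unital_algebra = K?: field K + A?: ring A + module K A
  for K (structure) and A (structure) +
  assumes algebra_one_not_zero: "\<one>\<^bsub>A\<^esub> \<noteq> \<zero>\<^bsub>A\<^esub>"
    and smult_mult_left:
      "\<lbrakk>c \<in> carrier K; x \<in> carrier A; y \<in> carrier A\<rbrakk> \<Longrightarrow>
        (c \<odot>\<^bsub>A\<^esub> x) \<otimes>\<^bsub>A\<^esub> y = c \<odot>\<^bsub>A\<^esub> (x \<otimes>\<^bsub>A\<^esub> y)"
    and smult_mult_right: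
      "\<lbrakk>c \<in> carrier K; x \<in> carrier A; y \<in> carrier A\<rbrakk> \<Longrightarrow>
        x \<otimes>\<^bsub>A\<^esub> (c \<odot>\<^bsub>A\<^esub> y) = c \<odot>\<^bsub>A\<^esub> (x \<otimes>\<^bsub>A\<^esub> y)"

text \<open>Membership in \<^const>\<open>ring_hom\<close> includes preservation of the unit.\<close>

locale unital_algebra_hom =
  dom: unital_algebra K A + cod: unital_algebra K B for K and A and B and f +
  assumes ring_hom: "f \<in> ring_hom A B"
    and hom_smult:
      "\<lbrakk>c \<in> carrier K; x \<in> carrier A\<rbrakk> \<Longrightarrow> f (c \<odot>\<^bsub>A\<^esub> x) = c \<odot>\<^bsub>B\<^esub> f x"


section \<open>Partial projective representations and factor sets\<close>

locale partial_sigma_representation =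
  group G + unital_algebra K R for K and G and \<sigma> and R and \<Gamma> +
  assumes sigma_closed: "\<sigma> \<in> carrier G \<times> carrier G \<rightarrow> carrier K"
    and rep_closed: "\<Gamma> \<in> carrier G \<rightarrow> carrier R"
    and rep_zero_left:
      "\<lbrakk>g \<in> carrier G; h \<in> carrier G; \<sigma> (g, h) = \<zero>\<^bsub>K\<^esub>\<rbrakk> \<Longrightarrow>
        \<Gamma> (inv\<^bsub>G\<^esub> g) \<otimes>\<^bsub>R\<^esub> \<Gamma> (g \<otimes>\<^bsub>G\<^esub> h) = \<zero>\<^bsub>R\<^esub>"
    and rep_zero_right:
      "\<lbrakk>g \<in> carrier G; h \<in> carrier G; \<sigma> (g, h) = \<zero>\<^bsub>K\<^esub>\<rbrakk> \<Longrightarrow>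
        \<Gamma> (g \<otimes>\<^bsub>G\<^esub> h) \<otimes>\<^bsub>R\<^esub> \<Gamma> (inv\<^bsub>G\<^esub> h) = \<zero>\<^bsub>R\<^esub>"
    and rep_mult_left:
      "\<lbrakk>g \<in> carrier G; h \<in> carrier G\<rbrakk> \<Longrightarrow>
        \<Gamma> (inv\<^bsub>G\<^esub> g) \<otimes>\<^bsub>R\<^esub> \<Gamma> g \<otimes>\<^bsub>R\<^esub> \<Gamma> h =
          \<sigma> (g, h) \<odot>\<^bsub>R\<^esub> (\<Gamma> (inv\<^bsub>G\<^esub> g) \<otimes>\<^bsub>R\<^esub> \<Gamma> (g \<otimes>\<^bsub>G\<^esub> h))"
    and rep_mult_right:
      "\<lbrakk>g \<in> carrier G; h \<in> carrier G\<rbrakk> \<Longrightarrow>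
        \<Gamma> g \<otimes>\<^bsub>R\<^esub> \<Gamma> h \<otimes>\<^bsub>R\<^esub> \<Gamma> (inv\<^bsub>G\<^esub> h) =
          \<sigma> (g, h) \<odot>\<^bsub>R\<^esub> (\<Gamma> (g \<otimes>\<^bsub>G\<^esub> h) \<otimes>\<^bsub>R\<^esub> \<Gamma> (inv\<^bsub>G\<^esub> h))"
    and rep_one: "\<Gamma> \<one>\<^bsub>G\<^esub> = \<one>\<^bsub>R\<^esub>"

definition partial_projective_representation ::
    "('k, 'c) ring_scheme \<Rightarrow> ('g, 'b) monoid_scheme \<Rightarrow> ('k, 'r, 'm) module_scheme
      \<Rightarrow> ('g \<Rightarrow> 'r) \<Rightarrow> bool"
  where "partial_projective_representation K G R \<Gamma> \<longleftrightarrow>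
    (\<exists>\<sigma>. partial_sigma_representation K G \<sigma> R \<Gamma>)"

definition is_factor_set ::
    "('k, 'c) ring_scheme \<Rightarrow> ('g, 'b) monoid_scheme \<Rightarrow> ('k, 'r, 'm) module_scheme
      \<Rightarrow> ('g \<Rightarrow> 'r) \<Rightarrow> ('g \<times> 'g \<Rightarrow> 'k) \<Rightarrow> bool"
  where "is_factor_set K G R \<Gamma> \<sigma> \<longleftrightarrow>
    partial_sigma_representation K G \<sigma> R \<Gamma> \<and>
    (\<forall>g\<in>carrier G. \<forall>h\<in>carrier G. \<Gamma> g \<otimes>\<^bsub>R\<^esub> \<Gamma> h = \<zero>\<^bsub>R\<^esub> \<longrightarrow> \<sigma> (g, h) = \<zero>\<^bsub>K\<^esub>)"

text \<open>
  HOL cannot quantify over types inside a formula, so the algebras in which the representations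
  live are taken over a type \<open>'s\<close> passed as an argument.  As a hypothesis of a theorem with \<open>'s\<close> a
  free type variable (not occurring elsewhere), \<open>\<sigma> \<in> pm TYPE('s) K G\<close> says that \<open>\<sigma>\<close> is a factor
  set of a partial projective representation in some algebra over an arbitrary type.
\<close>

definition pm ::
    "'s itself \<Rightarrow> ('k, 'c) ring_scheme \<Rightarrow> ('g, 'b) monoid_scheme \<Rightarrow> ('g \<times> 'g \<Rightarrow> 'k) set"
  where "pm _ K G =
    {\<sigma>. \<exists>(R :: ('k, 's) module) \<Gamma>.
      partial_projective_representation K G R \<Gamma> \<and> is_factor_set K G R \<Gamma> \<sigma>}"


section \<open>The free unital algebra on a set\<close>

text \<open>
  Elements are finitely supported functions from words over \<open>X\<close> to the scalars; they are zero on
  words that are not over \<open>X\<close>.  The product is the convolution over all splittings of a word.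
\<close>

definition free_algebra ::
    "('k, 'c) ring_scheme \<Rightarrow> 'x set \<Rightarrow> ('k, 'x list \<Rightarrow> 'k) module"
  where "free_algebra K X =
    \<lparr>carrier = {p. range p \<subseteq> carrier K \<and> {w. p w \<noteq> \<zero>\<^bsub>K\<^esub>} \<subseteq> lists X \<and> finite {w. p w \<noteq> \<zero>\<^bsub>K\<^esub>}},
     mult = (\<lambda>p q w. \<Oplus>\<^bsub>K\<^esub>i\<in>{..length w}. p (take i w) \<otimes>\<^bsub>K\<^esub> q (drop i w)),
     one = (\<lambda>w. if w = [] then \<one>\<^bsub>K\<^esub> else \<zero>\<^bsub>K\<^esub>),
     zero = (\<lambda>w. \<zero>\<^bsub>K\<^esub>),
     add = (\<lambda>p q w. p w \<oplus>\<^bsub>K\<^esub> q w),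
     smult = (\<lambda>c p w. c \<otimes>\<^bsub>K\<^esub> p w)\<rparr>"

definition free_gen :: "('k, 'c) ring_scheme \<Rightarrow> 'x \<Rightarrow> 'x list \<Rightarrow> 'k"
  where "free_gen K x = (\<lambda>w. if w = [x] then \<one>\<^bsub>K\<^esub> else \<zero>\<^bsub>K\<^esub>)"


section \<open>Quotient of an algebra by a two-sided ideal\<close>

text \<open>The scalar multiplication on cosets is defined in the style of \<^const>\<open>rcoset_mult\<close>.\<close>

definition quot_algebra ::
    "('k, 'a, 'm) module_scheme \<Rightarrow> 'a set \<Rightarrow> ('k, 'a set) module"
  where "quot_algebra A I =
    \<lparr>carrier = carrier (A Quot I),
     mult = mult (A Quot I),
     one = one (A Quot I),
     zero = zero (A Quot I),
     add = add (A Quot I),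
     smult = (\<lambda>c C. \<Union>x\<in>C. I +>\<^bsub>A\<^esub> (c \<odot>\<^bsub>A\<^esub> x))\<rparr>"


section \<open>The twisted partial group algebra\<close>

text \<open>
  Elements of the free algebra on \<open>G\<close> that are to become zero.  The last relation identifies the
  symbol of the neutral element with the unit of the algebra.  In a \<^emph>\<open>unital\<close> presentation this
  is not a consequence of the two preceding families, which only make that symbol a unit for the
  subalgebra without unit generated by the symbols.
\<close>

definition twisted_relations ::
    "('k, 'c) ring_scheme \<Rightarrow> ('g, 'b) monoid_scheme \<Rightarrow> ('g \<times> 'g \<Rightarrow> 'k) \<Rightarrow> ('g list \<Rightarrow> 'k) set"
  where "twisted_relations K G \<sigma> = (let F = free_algebra K (carrier G); x = free_gen K in
      {x (inv\<^bsub>G\<^esub> g) \<otimes>\<^bsub>F\<^esub> x (g \<otimes>\<^bsub>G\<^esub> h) | g h.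
        g \<in> carrier G \<and> h \<in> carrier G \<and> \<sigma> (g, h) = \<zero>\<^bsub>K\<^esub>}
    \<union> {x (g \<otimes>\<^bsub>G\<^esub> h) \<otimes>\<^bsub>F\<^esub> x (inv\<^bsub>G\<^esub> h) | g h.
        g \<in> carrier G \<and> h \<in> carrier G \<and> \<sigma> (g, h) = \<zero>\<^bsub>K\<^esub>}
    \<union> {(x (inv\<^bsub>G\<^esub> g) \<otimes>\<^bsub>F\<^esub> x g \<otimes>\<^bsub>F\<^esub> x h) \<ominus>\<^bsub>F\<^esub>
        (\<sigma> (g, h) \<odot>\<^bsub>F\<^esub> (x (inv\<^bsub>G\<^esub> g) \<otimes>\<^bsub>F\<^esub> x (g \<otimes>\<^bsub>G\<^esub> h))) | g h.
        g \<in> carrier G \<and> h \<in> carrier G}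
    \<union> {(x g \<otimes>\<^bsub>F\<^esub> x h \<otimes>\<^bsub>F\<^esub> x (inv\<^bsub>G\<^esub> h)) \<ominus>\<^bsub>F\<^esub>
        (\<sigma> (g, h) \<odot>\<^bsub>F\<^esub> (x (g \<otimes>\<^bsub>G\<^esub> h) \<otimes>\<^bsub>F\<^esub> x (inv\<^bsub>G\<^esub> h))) | g h.
        g \<in> carrier G \<and> h \<in> carrier G}
    \<union> {(x g \<otimes>\<^bsub>F\<^esub> x \<one>\<^bsub>G\<^esub>) \<ominus>\<^bsub>F\<^esub> x g | g. g \<in> carrier G}
    \<union> {(x \<one>\<^bsub>G\<^esub> \<otimes>\<^bsub>F\<^esub> x g) \<ominus>\<^bsub>F\<^esub> x g | g. g \<in> carrier G}
    \<union> {x \<one>\<^bsub>G\<^esub> \<ominus>\<^bsub>F\<^esub> \<one>\<^bsub>F\<^esub>})"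

definition twisted_ideal ::
    "('k, 'c) ring_scheme \<Rightarrow> ('g, 'b) monoid_scheme \<Rightarrow> ('g \<times> 'g \<Rightarrow> 'k) \<Rightarrow> ('g list \<Rightarrow> 'k) set"
  where "twisted_ideal K G \<sigma> =
    Idl\<^bsub>free_algebra K (carrier G)\<^esub> (twisted_relations K G \<sigma>)"

definition twisted_partial_group_algebra ::
    "('k, 'c) ring_scheme \<Rightarrow> ('g, 'b) monoid_scheme \<Rightarrow> ('g \<times> 'g \<Rightarrow> 'k)
      \<Rightarrow> ('k, ('g list \<Rightarrow> 'k) set) module"
  where "twisted_partial_group_algebra K G \<sigma> =
    quot_algebra (free_algebra K (carrier G)) (twisted_ideal K G \<sigma>)"

definition twisted_gen ::
    "('k, 'c) ring_scheme \<Rightarrow> ('g, 'b) monoid_scheme \<Rightarrow> ('g \<times> 'g \<Rightarrow> 'k)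
      \<Rightarrow> 'g \<Rightarrow> ('g list \<Rightarrow> 'k) set"
  where "twisted_gen K G \<sigma> g =
    twisted_ideal K G \<sigma> +>\<^bsub>free_algebra K (carrier G)\<^esub> free_gen K g"

end

theory Submission
  imports Defs
begin

text \<open>
  The twisted partial group algebra is the free unital algebra \<open>F\<close> on the set \<open>G\<close> modulo the
  two-sided ideal generated by the relations, so homomorphisms out of it are the homomorphisms
  out of \<open>F\<close> that vanish on the relations.  Every map \<open>\<Gamma>\<close> on the generators extends to exactly
  one homomorphism \<open>f\<close> out of \<open>F\<close> (\<open>free_algebra_hom_exists\<close>, \<open>free_algebra_hom_eqI\<close>), and
  applying \<open>f\<close> to the relations turns them literally into the axioms of a partial
  \<open>\<sigma>\<close>-representation for \<open>\<Gamma>\<close>.  The resulting equivalence \<open>hom_zero_on_relations_iff\<close> gives both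
  halves of the proposition: read from right to left it lets a representation descend to the
  quotient, and read from left to right, for the composite of a given homomorphism with the
  projection \<open>F \<rightarrow> F / I\<close>, it produces a representation.

  Since algebras must satisfy \<open>1 \<noteq> 0\<close>, the quotient is an algebra only if the ideal is proper.
  In the first half this follows from the given representation, because a unital homomorphism
  to an algebra with \<open>1 \<noteq> 0\<close> that vanishes on the ideal cannot send \<open>1\<close> to zero; in the second half
  it is part of having a homomorphism defined on the quotient.  A factor set takes its values in
  the field, which places the relations, with their scalar multiples by \<open>\<sigma>\<close>, inside \<open>F\<close>.

  Most of the work is the concrete model of \<open>F\<close>.  Convolution over splittings of a word satisfies
  a recursion on the first letter (\<open>convolution_Cons\<close>), which gives associativity by induction on
  the word instead of by rearranging a double sum.
\<close>


section \<open>The free algebra is an algebra\<close>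

text \<open>
  The formulas for the product make sense for arbitrary coefficient functions, that is, for formal
  power series in non-commuting variables.  The algebraic laws are proved in that generality, where
  the inductions on words can pass to shifted coefficient functions without tracking supports.
\<close>

locale free_algebra_on = K?: field K for K (structure) and X :: "'x set"
begin

abbreviation F where "F \<equiv> free_algebra K X"

lemma free_algebra_simps:
  "p \<otimes>\<^bsub>F\<^esub> q = (\<lambda>w. \<Oplus>i\<in>{..length w}. p (take i w) \<otimes> q (drop i w))"
  "\<one>\<^bsub>F\<^esub> = (\<lambda>w. if w = [] then \<one> else \<zero>)"
  "\<zero>\<^bsub>F\<^esub> = (\<lambda>w. \<zero>)"
  "p \<oplus>\<^bsub>F\<^esub> q = (\<lambda>w. p w \<oplus> q w)"
  "c \<odot>\<^bsub>F\<^esub> p = (\<lambda>w. c \<otimes> p w)"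
  by (simp_all add: free_algebra_def fun_eq_iff)

lemma free_algebra_carrier_iff:
  "p \<in> carrier F \<longleftrightarrow>
    (\<forall>w. p w \<in> carrier K) \<and> (\<forall>w. p w \<noteq> \<zero> \<longrightarrow> w \<in> lists X) \<and> finite {w. p w \<noteq> \<zero>}"
  unfolding free_algebra_def by auto

lemma coeff_closed: "p \<in> carrier F \<Longrightarrow> p w \<in> carrier K"
  by (simp add: free_algebra_carrier_iff)

lemma free_algebra_memI:
  assumes "\<And>w. p w \<in> carrier K" and "\<And>w. p w \<noteq> \<zero> \<Longrightarrow> w \<in> S" and "S \<subseteq> lists X" and "finite S"
  shows "p \<in> carrier F"
proof -
  have "{w. p w \<noteq> \<zero>} \<subseteq> S" using assms(2) by auto
  then show ?thesis
    using assms finite_subset unfolding free_algebra_carrier_iff by blast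
qed

lemma convolution_Nil:
  assumes "p [] \<in> carrier K" "q [] \<in> carrier K"
  shows "(p \<otimes>\<^bsub>F\<^esub> q) [] = p [] \<otimes> q []"
  using assms by (simp add: free_algebra_simps)

text \<open>
  A splitting of \<open>a # w\<close> either has an empty left part, or arises from a splitting of \<open>w\<close> by
  putting \<open>a\<close> in front of the left part.
\<close>

lemma convolution_Cons:
  assumes "\<And>w. p w \<in> carrier K" "\<And>w. q w \<in> carrier K"
  shows "(p \<otimes>\<^bsub>F\<^esub> q) (a # w) = ((\<lambda>v. p (a # v)) \<otimes>\<^bsub>F\<^esub> q) w \<oplus> p [] \<otimes> q (a # w)"
proof -
  have "(\<Oplus>i\<in>{..Suc (length w)}. p (take i (a # w)) \<otimes> q (drop i (a # w)))
      = (\<Oplus>i\<in>{..length w}. p (take (Suc i) (a # w)) \<otimes> q (drop (Suc i) (a # w)))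
        \<oplus> p (take 0 (a # w)) \<otimes> q (drop 0 (a # w))"
    by (rule K.finsum_Suc2) (auto simp: assms)
  then show ?thesis by (simp add: free_algebra_simps)
qed

lemma convolution_coeff_closed:
  assumes "\<And>w. p w \<in> carrier K" "\<And>w. q w \<in> carrier K"
  shows "(p \<otimes>\<^bsub>F\<^esub> q) w \<in> carrier K"
  using assms by (auto simp: free_algebra_simps intro!: K.finsum_closed)

lemma convolution_add_left:
  assumes "\<And>w. p w \<in> carrier K" "\<And>w. q w \<in> carrier K" "\<And>w. r w \<in> carrier K"
  shows "((p \<oplus>\<^bsub>F\<^esub> q) \<otimes>\<^bsub>F\<^esub> r) w = (p \<otimes>\<^bsub>F\<^esub> r) w \<oplus> (q \<otimes>\<^bsub>F\<^esub> r) w"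
  using assms by (simp add: free_algebra_simps K.l_distr K.finsum_addf Pi_def)

lemma convolution_add_right:
  assumes "\<And>w. p w \<in> carrier K" "\<And>w. q w \<in> carrier K" "\<And>w. r w \<in> carrier K"
  shows "(r \<otimes>\<^bsub>F\<^esub> (p \<oplus>\<^bsub>F\<^esub> q)) w = (r \<otimes>\<^bsub>F\<^esub> p) w \<oplus> (r \<otimes>\<^bsub>F\<^esub> q) w"
  using assms by (simp add: free_algebra_simps K.r_distr K.finsum_addf Pi_def)

lemma convolution_smult_left:
  assumes "c \<in> carrier K" "\<And>w. p w \<in> carrier K" "\<And>w. q w \<in> carrier K"
  shows "((c \<odot>\<^bsub>F\<^esub> p) \<otimes>\<^bsub>F\<^esub> q) w = c \<otimes> (p \<otimes>\<^bsub>F\<^esub> q) w"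
  using assms by (simp add: free_algebra_simps K.m_assoc K.finsum_rdistr Pi_def)

lemma convolution_smult_right:
  assumes "c \<in> carrier K" "\<And>w. p w \<in> carrier K" "\<And>w. q w \<in> carrier K"
  shows "(p \<otimes>\<^bsub>F\<^esub> (c \<odot>\<^bsub>F\<^esub> q)) w = c \<otimes> (p \<otimes>\<^bsub>F\<^esub> q) w"
  using assms by (simp add: free_algebra_simps K.m_lcomm K.finsum_rdistr Pi_def)

text \<open>
  Write \<open>p\<^sub>a\<close> for the series \<open>v \<mapsto> p (a # v)\<close> and \<open>p\<^sub>0\<close> for the constant coefficient.  The recursion
  says that \<open>(p q)\<^sub>a = p\<^sub>a q + p\<^sub>0 q\<^sub>a\<close>.  Both sides of the associative law therefore expand to
  \<open>p\<^sub>a q r + p\<^sub>0 q\<^sub>a r + p\<^sub>0 q\<^sub>0 r\<^sub>a\<close>, where only shorter words enter into the triple product.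
\<close>

lemma convolution_assoc:
  assumes "\<And>w. p w \<in> carrier K" "\<And>w. q w \<in> carrier K" "\<And>w. r w \<in> carrier K"
  shows "((p \<otimes>\<^bsub>F\<^esub> q) \<otimes>\<^bsub>F\<^esub> r) w = (p \<otimes>\<^bsub>F\<^esub> (q \<otimes>\<^bsub>F\<^esub> r)) w"
  using assms(1,2)
proof (induction w arbitrary: p q)
  case Nil
  show ?case
    using Nil assms(3) by (simp add: convolution_Nil convolution_coeff_closed K.m_assoc)
next
  case (Cons a w)
  let ?p = "\<lambda>v. p (a # v)" and ?q = "\<lambda>v. q (a # v)"
  note [simp] = convolution_coeff_closed Cons.prems assms(3)
  have "((p \<otimes>\<^bsub>F\<^esub> q) \<otimes>\<^bsub>F\<^esub> r) (a # w)
      = (((?p \<otimes>\<^bsub>F\<^esub> q) \<oplus>\<^bsub>F\<^esub> (p [] \<odot>\<^bsub>F\<^esub> ?q)) \<otimes>\<^bsub>F\<^esub> r) w \<oplus> p [] \<otimes> q [] \<otimes> r (a # w)"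
  proof -
    have "(\<lambda>v. (p \<otimes>\<^bsub>F\<^esub> q) (a # v)) = (?p \<otimes>\<^bsub>F\<^esub> q) \<oplus>\<^bsub>F\<^esub> (p [] \<odot>\<^bsub>F\<^esub> ?q)"
      by (simp add: convolution_Cons free_algebra_simps(4,5))
    then show ?thesis
      by (subst convolution_Cons) (simp_all add: convolution_Nil)
  qed
  also have "\<dots> = ((?p \<otimes>\<^bsub>F\<^esub> q) \<otimes>\<^bsub>F\<^esub> r) w \<oplus> p [] \<otimes> (?q \<otimes>\<^bsub>F\<^esub> r) w \<oplus> p [] \<otimes> q [] \<otimes> r (a # w)"
    by (subst convolution_add_left)
      (simp_all add: convolution_smult_left, simp add: free_algebra_simps(5))
  also have "\<dots> = (?p \<otimes>\<^bsub>F\<^esub> (q \<otimes>\<^bsub>F\<^esub> r)) w \<oplus> p [] \<otimes> (q \<otimes>\<^bsub>F\<^esub> r) (a # w)"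
    by (simp add: Cons.IH convolution_Cons K.r_distr K.a_assoc K.m_assoc)
  also have "\<dots> = (p \<otimes>\<^bsub>F\<^esub> (q \<otimes>\<^bsub>F\<^esub> r)) (a # w)"
    by (subst convolution_Cons) simp_all
  finally show ?case .
qed

lemma convolution_one_left:
  assumes "\<And>w. p w \<in> carrier K"
  shows "(\<one>\<^bsub>F\<^esub> \<otimes>\<^bsub>F\<^esub> p) w = p w"
proof (cases w)
  case Nil
  then show ?thesis by (simp add: convolution_Nil assms free_algebra_simps(2))
next
  case (Cons a v)
  have "(\<lambda>v. \<one>\<^bsub>F\<^esub> (a # v)) \<otimes>\<^bsub>F\<^esub> p = (\<lambda>_. \<zero>)"
    by (simp add: free_algebra_simps assms)
  then show ?thesis
    using Cons by (simp add: convolution_Cons assms free_algebra_simps(2))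
qed

lemma convolution_one_right:
  assumes "\<And>w. p w \<in> carrier K"
  shows "(p \<otimes>\<^bsub>F\<^esub> \<one>\<^bsub>F\<^esub>) w = p w"
  using assms
proof (induction w arbitrary: p)
  case Nil
  then show ?case by (simp add: convolution_Nil free_algebra_simps(2))
next
  case (Cons a w)
  then show ?case
    by (subst convolution_Cons) (simp_all add: free_algebra_simps(2))
qed

lemma zero_mem_free_algebra: "\<zero>\<^bsub>F\<^esub> \<in> carrier F"
  by (rule free_algebra_memI[of _ "{}"]) (auto simp: free_algebra_simps)

lemma one_mem_free_algebra: "\<one>\<^bsub>F\<^esub> \<in> carrier F"
  by (rule free_algebra_memI[of _ "{[]}"]) (auto simp: free_algebra_simps split: if_splits)

lemma free_gen_mem: "x \<in> X \<Longrightarrow> free_gen K x \<in> carrier F"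
  by (rule free_algebra_memI[of _ "{[x]}"]) (auto simp: free_gen_def split: if_splits)

lemma smult_mem_free_algebra:
  assumes "c \<in> carrier K" "p \<in> carrier F"
  shows "c \<odot>\<^bsub>F\<^esub> p \<in> carrier F"
  by (rule free_algebra_memI[of _ "{w. p w \<noteq> \<zero>}"])
    (use assms in \<open>auto simp: free_algebra_simps free_algebra_carrier_iff\<close>)

lemma add_mem_free_algebra:
  assumes "p \<in> carrier F" "q \<in> carrier F"
  shows "p \<oplus>\<^bsub>F\<^esub> q \<in> carrier F"
  by (rule free_algebra_memI[of _ "{w. p w \<noteq> \<zero>} \<union> {w. q w \<noteq> \<zero>}"])
    (use assms in \<open>auto simp: free_algebra_simps free_algebra_carrier_iff\<close>)

lemma mult_mem_free_algebra:
  assumes "p \<in> carrier F" "q \<in> carrier F"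
  shows "p \<otimes>\<^bsub>F\<^esub> q \<in> carrier F"
proof (rule free_algebra_memI[of _ "(\<lambda>(u, v). u @ v) ` ({w. p w \<noteq> \<zero>} \<times> {w. q w \<noteq> \<zero>})"])
  show "(p \<otimes>\<^bsub>F\<^esub> q) w \<in> carrier K" for w
    using assms by (intro convolution_coeff_closed) (auto intro: coeff_closed)
  show "w \<in> (\<lambda>(u, v). u @ v) ` ({w. p w \<noteq> \<zero>} \<times> {w. q w \<noteq> \<zero>})"
    if "(p \<otimes>\<^bsub>F\<^esub> q) w \<noteq> \<zero>" for w
  proof -
    have "\<exists>i\<in>{..length w}. p (take i w) \<otimes> q (drop i w) \<noteq> \<zero>"
    proof (rule ccontr)
      assume "\<not> ?thesis"
      then have "(\<Oplus>i\<in>{..length w}. p (take i w) \<otimes> q (drop i w)) = \<zero>"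
        by (intro K.add.finprod_one_eqI) auto
      with that show False by (simp add: free_algebra_simps(1))
    qed
    then obtain i where "p (take i w) \<otimes> q (drop i w) \<noteq> \<zero>" by blast
    then have "p (take i w) \<noteq> \<zero>" "q (drop i w) \<noteq> \<zero>"
      using assms by (metis K.l_null K.r_null coeff_closed)+
    then show ?thesis
      by (intro image_eqI[where x = "(take i w, drop i w)"]) auto
  qed
  show "(\<lambda>(u, v). u @ v) ` ({w. p w \<noteq> \<zero>} \<times> {w. q w \<noteq> \<zero>}) \<subseteq> lists X"
    using assms unfolding free_algebra_carrier_iff by force
  show "finite ((\<lambda>(u, v). u @ v) ` ({w. p w \<noteq> \<zero>} \<times> {w. q w \<noteq> \<zero>}))"
    using assms unfolding free_algebra_carrier_iff by blast
qed

lemma ring_free_algebra: "ring F"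
proof (rule ringI)
  note coeff = coeff_closed
  show "abelian_group F"
  proof (rule abelian_groupI)
    (* The negative is taken as a scalar multiple, so that closure under scalars covers it. *)
    show "\<exists>q\<in>carrier F. q \<oplus>\<^bsub>F\<^esub> p = \<zero>\<^bsub>F\<^esub>" if "p \<in> carrier F" for p
    proof (rule bexI[where x = "(\<ominus> \<one>) \<odot>\<^bsub>F\<^esub> p"])
      show "(\<ominus> \<one>) \<odot>\<^bsub>F\<^esub> p \<in> carrier F"
        using that by (intro smult_mem_free_algebra) auto
      show "(\<ominus> \<one>) \<odot>\<^bsub>F\<^esub> p \<oplus>\<^bsub>F\<^esub> p = \<zero>\<^bsub>F\<^esub>"
        using coeff[OF that] by (simp add: free_algebra_simps K.l_minus K.l_neg)
    qed
  qed (simp_all add: add_mem_free_algebra zero_mem_free_algebra,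
      simp_all add: free_algebra_simps(3,4) coeff K.a_ac)
  show "monoid F"
    by (rule monoidI)
      (auto simp: mult_mem_free_algebra one_mem_free_algebra coeff fun_eq_iff
        convolution_assoc convolution_one_left convolution_one_right)
  show "(p \<oplus>\<^bsub>F\<^esub> q) \<otimes>\<^bsub>F\<^esub> r = p \<otimes>\<^bsub>F\<^esub> r \<oplus>\<^bsub>F\<^esub> q \<otimes>\<^bsub>F\<^esub> r"
    if "p \<in> carrier F" "q \<in> carrier F" "r \<in> carrier F" for p q r
    using that by (auto simp: fun_eq_iff convolution_add_left coeff free_algebra_simps(4)
        convolution_add_left[unfolded free_algebra_simps(4)])
  show "r \<otimes>\<^bsub>F\<^esub> (p \<oplus>\<^bsub>F\<^esub> q) = r \<otimes>\<^bsub>F\<^esub> p \<oplus>\<^bsub>F\<^esub> r \<otimes>\<^bsub>F\<^esub> q"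
    if "p \<in> carrier F" "q \<in> carrier F" "r \<in> carrier F" for p q r
    using that by (auto simp: fun_eq_iff coeff free_algebra_simps(4)
        convolution_add_right[unfolded free_algebra_simps(4)])
qed

lemma unital_algebra_free_algebra: "unital_algebra K F"
proof (intro unital_algebra.intro unital_algebra_axioms.intro)
  show "field K" by (rule K.field_axioms)
  show "ring F" by (rule ring_free_algebra)
  then interpret F: ring F .
  note coeff = coeff_closed
  show "module K F"
  proof (rule moduleI)
    show "cring K" by (rule K.is_cring)
    show "abelian_group F" by (rule F.abelian_group_axioms)
  qed (simp_all add: smult_mem_free_algebra,
      simp_all add: free_algebra_simps(4,5) coeff K.l_distr K.r_distr K.m_assoc)
  show "\<one>\<^bsub>F\<^esub> \<noteq> \<zero>\<^bsub>F\<^esub>"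
    by (auto simp: free_algebra_simps fun_eq_iff)
  show "c \<odot>\<^bsub>F\<^esub> p \<otimes>\<^bsub>F\<^esub> q = c \<odot>\<^bsub>F\<^esub> (p \<otimes>\<^bsub>F\<^esub> q)"
    if "c \<in> carrier K" "p \<in> carrier F" "q \<in> carrier F" for c p q
    using that by (auto simp: fun_eq_iff coeff free_algebra_simps(5)
        convolution_smult_left[unfolded free_algebra_simps(5)])
  show "p \<otimes>\<^bsub>F\<^esub> (c \<odot>\<^bsub>F\<^esub> q) = c \<odot>\<^bsub>F\<^esub> (p \<otimes>\<^bsub>F\<^esub> q)"
    if "c \<in> carrier K" "p \<in> carrier F" "q \<in> carrier F" for c p q
    using that by (auto simp: fun_eq_iff coeff free_algebra_simps(5)
        convolution_smult_right[unfolded free_algebra_simps(5)])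
qed

sublocale F: unital_algebra K F
  by (rule unital_algebra_free_algebra)

lemma free_gen_mult_Nil:
  assumes "p \<in> carrier F"
  shows "(free_gen K x \<otimes>\<^bsub>F\<^esub> p) [] = \<zero>"
  using assms by (simp add: convolution_Nil free_gen_def coeff_closed)

lemma free_gen_mult_Cons:
  assumes "p \<in> carrier F"
  shows "(free_gen K x \<otimes>\<^bsub>F\<^esub> p) (a # w) = (if a = x then p w else \<zero>)"
proof -
  have "(\<lambda>v. free_gen K x (a # v)) = (if a = x then \<one>\<^bsub>F\<^esub> else \<zero>\<^bsub>F\<^esub>)"
    by (auto simp: free_gen_def free_algebra_simps)
  moreover have "(free_gen K x \<otimes>\<^bsub>F\<^esub> p) (a # w)
      = ((\<lambda>v. free_gen K x (a # v)) \<otimes>\<^bsub>F\<^esub> p) w \<oplus> free_gen K x [] \<otimes> p (a # w)"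
    using assms by (intro convolution_Cons) (auto simp: coeff_closed free_gen_def)
  ultimately show ?thesis
    using assms by (auto simp: free_gen_def[of _ x] coeff_closed
        F.A.l_null[unfolded free_algebra_simps(3)] free_algebra_simps(3))
qed

text \<open>
  The generators generate the free algebra: every word is obtained from the unit by multiplying
  generators on the left, and a finitely supported function is a finite combination of words.
\<close>

lemma free_algebra_induct [consumes 1, case_names one gen_mult smult add]:
  assumes "p \<in> carrier F"
    and one: "P \<one>\<^bsub>F\<^esub>"
    and gen: "\<And>x p. \<lbrakk>x \<in> X; p \<in> carrier F; P p\<rbrakk> \<Longrightarrow> P (free_gen K x \<otimes>\<^bsub>F\<^esub> p)"
    and smult: "\<And>c p. \<lbrakk>c \<in> carrier K; p \<in> carrier F; P p\<rbrakk> \<Longrightarrow> P (c \<odot>\<^bsub>F\<^esub> p)"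
    and add: "\<And>p q. \<lbrakk>p \<in> carrier F; q \<in> carrier F; P p; P q\<rbrakk> \<Longrightarrow> P (p \<oplus>\<^bsub>F\<^esub> q)"
  shows "P p"
proof -
  define mon where "mon w = (\<lambda>v. if v = w then \<one> else \<zero>)" for w :: "'x list"
  have mon_mem: "mon w \<in> carrier F" if "w \<in> lists X" for w
    using that by (intro free_algebra_memI[of _ "{w}"]) (auto simp: mon_def split: if_splits)
  have mon: "P (mon w)" if "w \<in> lists X" for w
    using that
  proof induction
    case Nil
    then show ?case using one by (simp add: mon_def free_algebra_simps(2))
  next
    case (Cons x w)
    have "(free_gen K x \<otimes>\<^bsub>F\<^esub> mon w) v = mon (x # w) v" for v
      using mon_mem[OF Cons.hyps(2)]
      by (cases v) (auto simp: free_gen_mult_Nil free_gen_mult_Cons mon_def)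
    then have "free_gen K x \<otimes>\<^bsub>F\<^esub> mon w = mon (x # w)" by blast
    then show ?case using gen[OF Cons.hyps(1) mon_mem[OF Cons.hyps(2)] Cons.IH] by simp
  qed
  (* Induction on a finite set containing the support, splitting off one word at a time. *)
  have "\<forall>p. p \<in> carrier F \<longrightarrow> {w. p w \<noteq> \<zero>} \<subseteq> S \<longrightarrow> P p" if "finite S" "S \<subseteq> lists X" for S
    using that
  proof induction
    case empty
    have "P p" if "p \<in> carrier F" "{w. p w \<noteq> \<zero>} \<subseteq> {}" for p
    proof -
      have "p = \<zero> \<odot>\<^bsub>F\<^esub> \<one>\<^bsub>F\<^esub>" using that by (auto simp: free_algebra_simps)
      then show ?thesis using smult[OF K.zero_closed F.A.one_closed one] by simp
    qed
    then show ?case by blast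
  next
    case (insert w S)
    have "P p" if p: "p \<in> carrier F" "{v. p v \<noteq> \<zero>} \<subseteq> insert w S" for p
    proof -
      let ?q = "p(w := \<zero>)"
      have q: "?q \<in> carrier F"
        using insert.prems insert.hyps p
        by (intro free_algebra_memI[of _ S]) (auto simp: coeff_closed split: if_splits)
      have "{v. ?q v \<noteq> \<zero>} \<subseteq> S" using p by (auto split: if_splits)
      then have "P ?q" using insert.IH insert.prems q by simp
      moreover have "p = p w \<odot>\<^bsub>F\<^esub> mon w \<oplus>\<^bsub>F\<^esub> ?q"
        using p by (auto simp: free_algebra_simps mon_def coeff_closed fun_eq_iff)
      moreover have "P (p w \<odot>\<^bsub>F\<^esub> mon w)"
        using insert.prems p by (intro smult mon mon_mem) (auto simp: coeff_closed)
      ultimately show ?thesis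
        using add[of "p w \<odot>\<^bsub>F\<^esub> mon w" ?q] q insert.prems p
        by (simp add: coeff_closed mon_mem)
    qed
    then show ?case by blast
  qed
  moreover have "finite {w. p w \<noteq> \<zero>}" "{w. p w \<noteq> \<zero>} \<subseteq> lists X"
    using assms(1) by (auto simp: free_algebra_carrier_iff)
  ultimately show ?thesis using assms(1) by blast
qed

end


section \<open>Algebra homomorphisms and quotient algebras\<close>

text \<open>
  A two-sided ideal of a unital algebra is automatically a subspace, because scalars act through
  multiples of the unit.
\<close>

lemma (in unital_algebra) smult_closed_ideal:
  assumes "ideal I A" "c \<in> carrier K" "x \<in> I"
  shows "c \<odot>\<^bsub>A\<^esub> x \<in> I"
proof -
  interpret I: ideal I A by fact
  have "c \<odot>\<^bsub>A\<^esub> x = (c \<odot>\<^bsub>A\<^esub> \<one>\<^bsub>A\<^esub>) \<otimes>\<^bsub>A\<^esub> x"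
    using assms by (simp add: smult_mult_left I.a_Hcarr)
  then show ?thesis using assms by (simp add: I.I_l_closed)
qed

context unital_algebra_hom
begin

sublocale rh?: ring_hom_ring A B f
  by (rule ring_hom_ringI2) (rule dom.A.ring_axioms cod.A.ring_axioms ring_hom)+

lemma hom_minus: "\<lbrakk>x \<in> carrier A; y \<in> carrier A\<rbrakk> \<Longrightarrow> f (x \<ominus>\<^bsub>A\<^esub> y) = f x \<ominus>\<^bsub>B\<^esub> f y"
  by (simp add: a_minus_def)

lemma hom_minus_eq_zero_iff:
  assumes "x \<in> carrier A" "y \<in> carrier A"
  shows "f (x \<ominus>\<^bsub>A\<^esub> y) = \<zero>\<^bsub>B\<^esub> \<longleftrightarrow> f x = f y"
  using assms
  by (metis cod.A.minus_equality cod.A.minus_minus cod.A.r_neg a_minus_def cod.A.add.inv_closed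
      hom_closed hom_minus)

lemma hom_eq_zero_on_Idl:
  assumes S: "S \<subseteq> carrier A" and zero: "\<And>x. x \<in> S \<Longrightarrow> f x = \<zero>\<^bsub>B\<^esub>"
    and "x \<in> Idl\<^bsub>A\<^esub> S"
  shows "f x = \<zero>\<^bsub>B\<^esub>"
proof -
  have kernel: "y \<in> a_kernel A B f \<longleftrightarrow> y \<in> carrier A \<and> f y = \<zero>\<^bsub>B\<^esub>" for y
    unfolding a_kernel_def' by blast
  have "S \<subseteq> a_kernel A B f"
    using S zero kernel by blast
  then have "Idl\<^bsub>A\<^esub> S \<subseteq> a_kernel A B f"
    by (rule dom.A.genideal_minimal[OF kernel_is_ideal])
  then show ?thesis using assms(3) kernel by blast
qed

end

lemma quot_algebra_simps:
  "carrier (quot_algebra A I) = a_rcosets\<^bsub>A\<^esub> I"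
  "mult (quot_algebra A I) = rcoset_mult A I"
  "one (quot_algebra A I) = I +>\<^bsub>A\<^esub> \<one>\<^bsub>A\<^esub>"
  "zero (quot_algebra A I) = I"
  "add (quot_algebra A I) = set_add A"
  by (simp_all add: quot_algebra_def FactRing_def)

text \<open>
  The ring axioms depend only on the ring fields of a record; this transports them from \<open>A Quot I\<close>
  to the quotient algebra, whose record type has the additional scalar multiplication.
\<close>

lemma ring_cong:
  assumes "ring A"
    and "carrier B = carrier A" "mult B = mult A" "one B = one A" "zero B = zero A" "add B = add A"
  shows "ring B"
proof (rule ringI)
  interpret A: ring A by fact
  show "abelian_group B"
    by (rule abelian_groupI) (simp_all add: assms A.a_ac A.add.l_inv_ex)
  show "monoid B"
    by (rule monoidI) (simp_all add: assms A.m_assoc)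
qed (simp_all add: assms(2-) ring.ring_simprules[OF assms(1)])

locale algebra_ideal = unital_algebra K A + I?: ideal I A for K (structure) and A (structure) and I
begin

abbreviation Q where "Q \<equiv> quot_algebra A I"

lemma ring_quot_algebra: "ring Q"
  by (rule ring_cong[OF I.quotient_is_ring]) (simp_all add: quot_algebra_def)

lemma quot_carrierE:
  assumes "C \<in> carrier Q"
  obtains x where "x \<in> carrier A" "C = I +>\<^bsub>A\<^esub> x"
  using assms by (auto simp: quot_algebra_simps A_RCOSETS_def')

lemma coset_mem: "x \<in> carrier A \<Longrightarrow> I +>\<^bsub>A\<^esub> x \<in> carrier Q"
  by (auto simp: quot_algebra_simps A_RCOSETS_def')

lemma coset_mult:
  "\<lbrakk>x \<in> carrier A; y \<in> carrier A\<rbrakk> \<Longrightarrow> (I +>\<^bsub>A\<^esub> x) \<otimes>\<^bsub>Q\<^esub> (I +>\<^bsub>A\<^esub> y) = I +>\<^bsub>A\<^esub> (x \<otimes>\<^bsub>A\<^esub> y)"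
  by (simp add: quot_algebra_simps I.rcoset_mult_add)

lemma coset_add:
  "\<lbrakk>x \<in> carrier A; y \<in> carrier A\<rbrakk> \<Longrightarrow> (I +>\<^bsub>A\<^esub> x) \<oplus>\<^bsub>Q\<^esub> (I +>\<^bsub>A\<^esub> y) = I +>\<^bsub>A\<^esub> (x \<oplus>\<^bsub>A\<^esub> y)"
  by (simp add: quot_algebra_simps I.a_rcos_sum)

lemma coset_smult:
  assumes c: "c \<in> carrier K" and x: "x \<in> carrier A"
  shows "c \<odot>\<^bsub>Q\<^esub> (I +>\<^bsub>A\<^esub> x) = I +>\<^bsub>A\<^esub> (c \<odot>\<^bsub>A\<^esub> x)"
proof -
  have "I +>\<^bsub>A\<^esub> (c \<odot>\<^bsub>A\<^esub> y) = I +>\<^bsub>A\<^esub> (c \<odot>\<^bsub>A\<^esub> x)" if "y \<in> I +>\<^bsub>A\<^esub> x" for y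
  proof -
    obtain i where i: "i \<in> I" "y = i \<oplus>\<^bsub>A\<^esub> x" using \<open>y \<in> _\<close> by (auto simp: a_r_coset_def')
    have "c \<odot>\<^bsub>A\<^esub> y = c \<odot>\<^bsub>A\<^esub> i \<oplus>\<^bsub>A\<^esub> c \<odot>\<^bsub>A\<^esub> x"
      using i c x by (simp add: smult_r_distr I.a_Hcarr)
    moreover have "c \<odot>\<^bsub>A\<^esub> i \<in> I"
      using c i by (intro smult_closed_ideal I.ideal_axioms)
    ultimately have "c \<odot>\<^bsub>A\<^esub> y \<in> I +>\<^bsub>A\<^esub> (c \<odot>\<^bsub>A\<^esub> x)"
      by (auto simp: a_r_coset_def')
    then show ?thesis using c x by (metis I.a_repr_independence' smult_closed)
  qed
  moreover have "x \<in> I +>\<^bsub>A\<^esub> x" using x by (rule I.a_rcos_self)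
  ultimately have "(\<Union>y\<in>I +>\<^bsub>A\<^esub> x. I +>\<^bsub>A\<^esub> (c \<odot>\<^bsub>A\<^esub> y)) = I +>\<^bsub>A\<^esub> (c \<odot>\<^bsub>A\<^esub> x)"
    by blast
  then show ?thesis by (simp add: quot_algebra_def)
qed

lemma coset_one: "\<one>\<^bsub>Q\<^esub> = I +>\<^bsub>A\<^esub> \<one>\<^bsub>A\<^esub>"
  by (simp add: quot_algebra_simps)

lemma unital_algebra_quot_algebra:
  assumes "\<one>\<^bsub>A\<^esub> \<notin> I"
  shows "unital_algebra K Q"
proof (intro unital_algebra.intro unital_algebra_axioms.intro)
  show "field K" by (rule K.field_axioms)
  show "ring Q" by (rule ring_quot_algebra)
  then interpret Q: ring Q .
  show "module K Q"
  proof (rule moduleI)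
    show "cring K" by (rule K.is_cring)
    show "abelian_group Q" by (rule Q.abelian_group_axioms)
  qed (auto elim!: quot_carrierE simp: coset_smult coset_add coset_mem
      smult_l_distr smult_r_distr smult_assoc1)
  show "\<one>\<^bsub>Q\<^esub> \<noteq> \<zero>\<^bsub>Q\<^esub>"
    using assms I.a_rcos_self[OF A.one_closed] by (auto simp: quot_algebra_simps)
qed (auto elim!: quot_carrierE simp: coset_smult coset_mult smult_mult_left smult_mult_right)

lemma coset_hom:
  assumes "\<one>\<^bsub>A\<^esub> \<notin> I"
  shows "unital_algebra_hom K A Q (\<lambda>x. I +>\<^bsub>A\<^esub> x)"
proof (intro unital_algebra_hom.intro unital_algebra_hom_axioms.intro)
  show "unital_algebra K A" by (rule unital_algebra_axioms)
  show "unital_algebra K Q" using assms by (rule unital_algebra_quot_algebra)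
qed (auto intro!: ring_hom_memI simp: coset_mem coset_mult coset_add coset_one coset_smult)

lemma coset_eq_zero_iff:
  assumes "x \<in> carrier A"
  shows "I +>\<^bsub>A\<^esub> x = \<zero>\<^bsub>Q\<^esub> \<longleftrightarrow> x \<in> I"
  using assms I.a_rcos_self I.a_rcos_const by (auto simp: quot_algebra_simps)

lemma one_notin_ideal_if_hom_zero:
  assumes "unital_algebra_hom K A B f" and "\<And>x. x \<in> I \<Longrightarrow> f x = \<zero>\<^bsub>B\<^esub>"
  shows "\<one>\<^bsub>A\<^esub> \<notin> I"
proof -
  interpret f: unital_algebra_hom K A B f by fact
  show ?thesis using assms(2) f.hom_one f.cod.algebra_one_not_zero by metis
qed

text \<open>
  A homomorphism that vanishes on \<open>I\<close> is constant on every coset, and its value there defines the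
  induced map.
\<close>

lemma quot_algebra_hom_exists:
  assumes f: "unital_algebra_hom K A B f" and zero: "\<And>x. x \<in> I \<Longrightarrow> f x = \<zero>\<^bsub>B\<^esub>"
  shows "\<exists>\<phi>\<in>extensional (carrier Q). unital_algebra_hom K Q B \<phi> \<and>
    (\<forall>x\<in>carrier A. \<phi> (I +>\<^bsub>A\<^esub> x) = f x)"
proof -
  interpret f: unital_algebra_hom K A B f by fact
  define \<phi> where "\<phi> = (\<lambda>C\<in>carrier Q. the_elem (f ` C))"
  have \<phi>: "\<phi> (I +>\<^bsub>A\<^esub> x) = f x" if x: "x \<in> carrier A" for x
  proof -
    have "f y = f x" if "y \<in> I +>\<^bsub>A\<^esub> x" for y
      using that x zero by (auto simp: a_r_coset_def' I.a_Hcarr f.hom_add f.hom_closed)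
    then have "f ` (I +>\<^bsub>A\<^esub> x) = {f x}" using I.a_rcos_self[OF x] by blast
    then show ?thesis using x by (simp add: \<phi>_def coset_mem)
  qed
  have "unital_algebra_hom K Q B \<phi>"
  proof (intro unital_algebra_hom.intro unital_algebra_hom_axioms.intro)
    show "unital_algebra K Q"
      by (rule unital_algebra_quot_algebra[OF one_notin_ideal_if_hom_zero[OF f zero]])
    show "unital_algebra K B" by (rule f.cod.unital_algebra_axioms)
    show "\<phi> \<in> ring_hom Q B"
      by (rule ring_hom_memI)
        (auto elim!: quot_carrierE simp: \<phi> coset_mult coset_add coset_one
          f.hom_closed f.hom_mult f.hom_add f.hom_one)
  qed (auto elim!: quot_carrierE simp: \<phi> coset_smult f.hom_smult)
  moreover have "\<phi> \<in> extensional (carrier Q)" by (simp add: \<phi>_def)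
  ultimately show ?thesis using \<phi> by blast
qed

end

lemma unital_algebra_hom_compose:
  assumes "unital_algebra_hom K A B f" "unital_algebra_hom K B C g"
  shows "unital_algebra_hom K A C (\<lambda>x. g (f x))"
proof -
  interpret f: unital_algebra_hom K A B f by fact
  interpret g: unital_algebra_hom K B C g by fact
  show ?thesis
    by (intro unital_algebra_hom.intro unital_algebra_hom_axioms.intro ring_hom_memI
        f.dom.unital_algebra_axioms g.cod.unital_algebra_axioms)
      (simp_all add: f.hom_closed g.hom_closed f.hom_mult g.hom_mult f.hom_add g.hom_add
        f.hom_one g.hom_one f.hom_smult g.hom_smult)
qed


section \<open>The universal property of the free algebra\<close>

fun word_value :: "('r, 'm) ring_scheme \<Rightarrow> ('x \<Rightarrow> 'r) \<Rightarrow> 'x list \<Rightarrow> 'r"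
  where
    "word_value R \<Gamma> [] = \<one>\<^bsub>R\<^esub>"
  | "word_value R \<Gamma> (x # w) = \<Gamma> x \<otimes>\<^bsub>R\<^esub> word_value R \<Gamma> w"

context free_algebra_on
begin

text \<open>
  The homomorphism evaluates each word in \<open>R\<close> and extends linearly.  Multiplicativity
  is proved by induction on the left factor along the generation of the free algebra, so that only
  the product with a single generator on the left has to be computed: it prefixes every word of the
  support with that generator.
\<close>

lemma free_algebra_hom_exists:
  assumes "unital_algebra K R" and \<Gamma>: "\<Gamma> \<in> X \<rightarrow> carrier R"
  shows "\<exists>f. unital_algebra_hom K F R f \<and> (\<forall>x\<in>X. f (free_gen K x) = \<Gamma> x)"
proof -
  interpret R: unital_algebra K R by fact
  let ?v = "word_value R \<Gamma>"
  have v: "?v w \<in> carrier R" if "w \<in> lists X" for w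
    using that \<Gamma> by induction auto
  define f where "f p = (\<Oplus>\<^bsub>R\<^esub>w\<in>{w. p w \<noteq> \<zero>}. p w \<odot>\<^bsub>R\<^esub> ?v w)" for p
  (* The sum may be taken over any finite set containing the support, which makes the sums
     for two elements comparable. *)
  have f_eq: "f p = (\<Oplus>\<^bsub>R\<^esub>w\<in>S. p w \<odot>\<^bsub>R\<^esub> ?v w)"
    if "p \<in> carrier F" "{w. p w \<noteq> \<zero>} \<subseteq> S" "S \<subseteq> lists X" "finite S" for p S
    unfolding f_def using that v
    by (intro R.A.add.finprod_mono_neutral_cong_left) (auto simp: coeff_closed subset_iff)
  have f_closed: "f p \<in> carrier R" if "p \<in> carrier F" for p
    unfolding f_def using that v
    by (intro R.A.finsum_closed) (auto simp: free_algebra_carrier_iff)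
  have f_add: "f (p \<oplus>\<^bsub>F\<^esub> q) = f p \<oplus>\<^bsub>R\<^esub> f q" if p: "p \<in> carrier F" and q: "q \<in> carrier F" for p q
  proof -
    let ?S = "{w. p w \<noteq> \<zero>} \<union> {w. q w \<noteq> \<zero>}"
    have S: "?S \<subseteq> lists X" "finite ?S" using p q unfolding free_algebra_carrier_iff by auto
    have summand_closed: "a \<odot>\<^bsub>R\<^esub> ?v w \<in> carrier R" if "w \<in> ?S" "a \<in> carrier K" for a w
      using that S v by (intro R.smult_closed) auto
    have "f (p \<oplus>\<^bsub>F\<^esub> q) = (\<Oplus>\<^bsub>R\<^esub>w\<in>?S. (p w \<oplus> q w) \<odot>\<^bsub>R\<^esub> ?v w)"
    proof -
      have "{w. (p \<oplus>\<^bsub>F\<^esub> q) w \<noteq> \<zero>} \<subseteq> ?S"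
        by (auto simp: free_algebra_simps(4))
      from f_eq[OF add_mem_free_algebra[OF p q] this S] show ?thesis
        by (simp add: free_algebra_simps(4))
    qed
    also have "\<dots> = (\<Oplus>\<^bsub>R\<^esub>w\<in>?S. p w \<odot>\<^bsub>R\<^esub> ?v w \<oplus>\<^bsub>R\<^esub> q w \<odot>\<^bsub>R\<^esub> ?v w)"
    proof (rule R.A.finsum_cong')
      fix w assume "w \<in> ?S"
      then have "w \<in> lists X" using S by blast
      then show "(p w \<oplus> q w) \<odot>\<^bsub>R\<^esub> ?v w = p w \<odot>\<^bsub>R\<^esub> ?v w \<oplus>\<^bsub>R\<^esub> q w \<odot>\<^bsub>R\<^esub> ?v w"
        using p q v by (intro R.smult_l_distr) (auto simp: coeff_closed)
    qed (use p q summand_closed coeff_closed in blast)+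
    also have "\<dots> = (\<Oplus>\<^bsub>R\<^esub>w\<in>?S. p w \<odot>\<^bsub>R\<^esub> ?v w) \<oplus>\<^bsub>R\<^esub> (\<Oplus>\<^bsub>R\<^esub>w\<in>?S. q w \<odot>\<^bsub>R\<^esub> ?v w)"
      using p q summand_closed coeff_closed by (intro R.A.finsum_addf) blast+
    also have "\<dots> = f p \<oplus>\<^bsub>R\<^esub> f q"
      using S p q by (simp add: f_eq[where S = ?S])
    finally show ?thesis .
  qed
  have f_smult: "f (c \<odot>\<^bsub>F\<^esub> p) = c \<odot>\<^bsub>R\<^esub> f p" if c: "c \<in> carrier K" and p: "p \<in> carrier F" for c p
  proof -
    let ?S = "{w. p w \<noteq> \<zero>}"
    have S: "?S \<subseteq> lists X" "finite ?S" using p unfolding free_algebra_carrier_iff by auto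
    have sum_smult: "(\<Oplus>\<^bsub>R\<^esub>w\<in>T. (c \<otimes> p w) \<odot>\<^bsub>R\<^esub> ?v w) = c \<odot>\<^bsub>R\<^esub> (\<Oplus>\<^bsub>R\<^esub>w\<in>T. p w \<odot>\<^bsub>R\<^esub> ?v w)"
      if "finite T" "T \<subseteq> lists X" for T
      using that
    proof induction
      case empty
      then show ?case using c by simp
    next
      case (insert w T)
      have *: "(\<lambda>w. a w \<odot>\<^bsub>R\<^esub> ?v w) \<in> insert w T \<rightarrow> carrier R" if "\<And>w. a w \<in> carrier K" for a
        using that insert.prems v by (intro Pi_I R.smult_closed) auto
      have **: "(\<lambda>w. a w \<odot>\<^bsub>R\<^esub> ?v w) \<in> T \<rightarrow> carrier R" "a w \<odot>\<^bsub>R\<^esub> ?v w \<in> carrier R"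
        if "\<And>w. a w \<in> carrier K" for a
        using *[of a, OF that] by auto
      have w: "?v w \<in> carrier R" using insert.prems v by auto
      show ?case
        using insert c p w **[of p] **[of "\<lambda>w. c \<otimes> p w"]
        by (simp add: coeff_closed R.smult_r_distr R.smult_assoc1 R.A.finsum_closed)
    qed
    show ?thesis
    proof -
      have "{w. (c \<odot>\<^bsub>F\<^esub> p) w \<noteq> \<zero>} \<subseteq> ?S"
        using c by (auto simp: free_algebra_simps(5))
      from f_eq[OF smult_mem_free_algebra[OF c p] this S] show ?thesis
        using sum_smult[OF S(2,1)] by (simp add: f_def free_algebra_simps(5))
    qed
  qed
  have f_gen_mult: "f (free_gen K x \<otimes>\<^bsub>F\<^esub> p) = \<Gamma> x \<otimes>\<^bsub>R\<^esub> f p"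
    if x: "x \<in> X" and p: "p \<in> carrier F" for x p
  proof -
    let ?S = "{w. p w \<noteq> \<zero>}"
    have S: "?S \<subseteq> lists X" "finite ?S" using p unfolding free_algebra_carrier_iff by auto
    have S_closed: "?v w \<in> carrier R" if "w \<in> ?S" for w using that S v by blast
    have \<Gamma>x: "\<Gamma> x \<in> carrier R" using x \<Gamma> by blast
    have supp: "{w. (free_gen K x \<otimes>\<^bsub>F\<^esub> p) w \<noteq> \<zero>} \<subseteq> (#) x ` ?S"
    proof
      fix w assume "w \<in> {w. (free_gen K x \<otimes>\<^bsub>F\<^esub> p) w \<noteq> \<zero>}"
      then show "w \<in> (#) x ` ?S"
        using p by (cases w) (auto simp: free_gen_mult_Nil free_gen_mult_Cons split: if_splits)
    qed
    have xp: "free_gen K x \<otimes>\<^bsub>F\<^esub> p \<in> carrier F" using x p by (simp add: free_gen_mem)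
    have "f (free_gen K x \<otimes>\<^bsub>F\<^esub> p)
        = (\<Oplus>\<^bsub>R\<^esub>w\<in>(#) x ` ?S. (free_gen K x \<otimes>\<^bsub>F\<^esub> p) w \<odot>\<^bsub>R\<^esub> ?v w)"
    proof (rule f_eq[OF xp supp])
      show "(#) x ` ?S \<subseteq> lists X"
        using S(1) x by (intro image_subsetI lists.Cons) blast+
    qed (use S(2) in simp)
    also have "\<dots> = (\<Oplus>\<^bsub>R\<^esub>w\<in>?S. (free_gen K x \<otimes>\<^bsub>F\<^esub> p) (x # w) \<odot>\<^bsub>R\<^esub> ?v (x # w))"
      using xp \<Gamma>x S_closed by (intro R.A.finsum_reindex) (auto simp: coeff_closed)
    also have "\<dots> = (\<Oplus>\<^bsub>R\<^esub>w\<in>?S. \<Gamma> x \<otimes>\<^bsub>R\<^esub> (p w \<odot>\<^bsub>R\<^esub> ?v w))"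
    proof (rule R.A.finsum_cong')
      fix w assume w: "w \<in> ?S"
      show "(free_gen K x \<otimes>\<^bsub>F\<^esub> p) (x # w) \<odot>\<^bsub>R\<^esub> ?v (x # w)
          = \<Gamma> x \<otimes>\<^bsub>R\<^esub> (p w \<odot>\<^bsub>R\<^esub> ?v w)"
        using p \<Gamma>x S_closed[OF w] by (simp add: free_gen_mult_Cons coeff_closed R.smult_mult_right)
    qed (use p \<Gamma>x S_closed in \<open>auto simp: coeff_closed\<close>)
    also have "\<dots> = \<Gamma> x \<otimes>\<^bsub>R\<^esub> f p"
      unfolding f_def using S p \<Gamma>x S_closed
      by (intro R.A.finsum_rdistr[symmetric]) (auto simp: coeff_closed)
    finally show ?thesis .
  qed
  have f_one: "f \<one>\<^bsub>F\<^esub> = \<one>\<^bsub>R\<^esub>"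
    by (subst f_eq[where S = "{[]}", OF one_mem_free_algebra])
      (auto simp: free_algebra_simps(2) split: if_splits)
  have f_mult: "f (p \<otimes>\<^bsub>F\<^esub> q) = f p \<otimes>\<^bsub>R\<^esub> f q" if "p \<in> carrier F" and q: "q \<in> carrier F" for p q
    using that(1)
  proof (induction rule: free_algebra_induct)
    case one
    then show ?case using q by (simp add: f_one f_closed)
  next
    case (gen_mult x p)
    then have "\<Gamma> x \<in> carrier R" using \<Gamma> by blast
    then show ?case
      using gen_mult q by (simp add: F.A.m_assoc free_gen_mem f_gen_mult f_closed R.A.m_assoc)
  next
    case (smult c p)
    then show ?case using q by (simp add: F.smult_mult_left f_smult f_closed R.smult_mult_left)
  next
    case (add p p')
    then show ?case using q by (simp add: F.A.l_distr f_add f_closed R.A.l_distr)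
  qed
  have "f (free_gen K x) = \<Gamma> x" if "x \<in> X" for x
  proof -
    have "\<Gamma> x \<in> carrier R" using that \<Gamma> by blast
    then show ?thesis
      using f_gen_mult[OF that F.A.one_closed] that by (simp add: free_gen_mem f_one)
  qed
  moreover have "unital_algebra_hom K F R f"
    by (intro unital_algebra_hom.intro unital_algebra_hom_axioms.intro ring_hom_memI
        unital_algebra_free_algebra R.unital_algebra_axioms)
      (simp_all add: f_closed f_mult f_add f_one f_smult)
  ultimately show ?thesis by blast
qed

lemma free_algebra_hom_eqI:
  assumes "unital_algebra_hom K F R f" "unital_algebra_hom K F R g"
    and eq: "\<And>x. x \<in> X \<Longrightarrow> f (free_gen K x) = g (free_gen K x)"
    and "p \<in> carrier F"
  shows "f p = g p"
proof -
  interpret f: unital_algebra_hom K F R f by fact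
  interpret g: unital_algebra_hom K F R g by fact
  show ?thesis
    using \<open>p \<in> carrier F\<close>
  proof (induction rule: free_algebra_induct)
    case one
    show ?case by (simp add: f.hom_one g.hom_one)
  next
    case (gen_mult x p)
    then show ?case by (simp add: f.hom_mult g.hom_mult free_gen_mem eq)
  qed (simp_all add: f.hom_smult g.hom_smult f.hom_add g.hom_add)
qed

end


section \<open>The universal property of the twisted partial group algebra\<close>

locale twisted_presentation = K?: field K + G?: group G
  for K :: "('k, 'c) ring_scheme" (structure) and G :: "('g, 'b) monoid_scheme" (structure)
    and \<sigma> +
  assumes twist_closed: "\<sigma> \<in> carrier G \<times> carrier G \<rightarrow> carrier K"
begin

sublocale free_algebra_on K "carrier G" ..

abbreviation I where "I \<equiv> twisted_ideal K G \<sigma>"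
abbreviation T where "T \<equiv> twisted_partial_group_algebra K G \<sigma>"

lemma twist_value_closed: "\<lbrakk>g \<in> carrier G; h \<in> carrier G\<rbrakk> \<Longrightarrow> \<sigma> (g, h) \<in> carrier K"
  using twist_closed by auto

lemma twisted_relationsI:
  "\<lbrakk>g \<in> carrier G; h \<in> carrier G; \<sigma> (g, h) = \<zero>\<rbrakk> \<Longrightarrow>
    free_gen K (inv\<^bsub>G\<^esub> g) \<otimes>\<^bsub>F\<^esub> free_gen K (g \<otimes>\<^bsub>G\<^esub> h) \<in> twisted_relations K G \<sigma>"
  "\<lbrakk>g \<in> carrier G; h \<in> carrier G; \<sigma> (g, h) = \<zero>\<rbrakk> \<Longrightarrow>
    free_gen K (g \<otimes>\<^bsub>G\<^esub> h) \<otimes>\<^bsub>F\<^esub> free_gen K (inv\<^bsub>G\<^esub> h) \<in> twisted_relations K G \<sigma>"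
  "\<lbrakk>g \<in> carrier G; h \<in> carrier G\<rbrakk> \<Longrightarrow>
    (free_gen K (inv\<^bsub>G\<^esub> g) \<otimes>\<^bsub>F\<^esub> free_gen K g \<otimes>\<^bsub>F\<^esub> free_gen K h)
      \<ominus>\<^bsub>F\<^esub> (\<sigma> (g, h) \<odot>\<^bsub>F\<^esub> (free_gen K (inv\<^bsub>G\<^esub> g) \<otimes>\<^bsub>F\<^esub> free_gen K (g \<otimes>\<^bsub>G\<^esub> h))) \<in> twisted_relations K G \<sigma>"
  "\<lbrakk>g \<in> carrier G; h \<in> carrier G\<rbrakk> \<Longrightarrow>
    (free_gen K g \<otimes>\<^bsub>F\<^esub> free_gen K h \<otimes>\<^bsub>F\<^esub> free_gen K (inv\<^bsub>G\<^esub> h))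
      \<ominus>\<^bsub>F\<^esub> (\<sigma> (g, h) \<odot>\<^bsub>F\<^esub> (free_gen K (g \<otimes>\<^bsub>G\<^esub> h) \<otimes>\<^bsub>F\<^esub> free_gen K (inv\<^bsub>G\<^esub> h))) \<in> twisted_relations K G \<sigma>"
  "free_gen K \<one>\<^bsub>G\<^esub> \<ominus>\<^bsub>F\<^esub> \<one>\<^bsub>F\<^esub> \<in> twisted_relations K G \<sigma>"
  unfolding twisted_relations_def Let_def by blast+

lemma twisted_relations_subset: "twisted_relations K G \<sigma> \<subseteq> carrier F"
  unfolding twisted_relations_def Let_def
  by (auto simp: free_gen_mem twist_value_closed)

text \<open>
  Because \<open>f\<close> is a homomorphism, its value on a relation is the difference of the two
  sides of an axiom for \<open>\<Gamma> = f \<circ> free_gen K\<close>.  The two families of relations saying that the symbol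
  of the neutral element is a unit for the other symbols have no axiom of their own: they follow
  from \<open>\<Gamma> 1 = 1\<close>.
\<close>

lemma hom_zero_on_relations_iff:
  assumes "unital_algebra_hom K F R f"
  shows "(\<forall>r\<in>twisted_relations K G \<sigma>. f r = \<zero>\<^bsub>R\<^esub>) \<longleftrightarrow>
    partial_sigma_representation K G \<sigma> R (\<lambda>g. f (free_gen K g))"
    (is "?zero \<longleftrightarrow> ?rep")
proof
  interpret f: unital_algebra_hom K F R f by fact
  note [simp] = f.hom_smult f.hom_minus_eq_zero_iff
    free_gen_mem twist_value_closed
  show ?rep if ?zero
  proof (intro partial_sigma_representation.intro partial_sigma_representation_axioms.intro)
    show "group G" by (rule G.is_group)
    show "unital_algebra K R" by (rule f.cod.unital_algebra_axioms)
    show "\<sigma> \<in> carrier G \<times> carrier G \<rightarrow> carrier K" by (rule twist_closed)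
    show "(\<lambda>g. f (free_gen K g)) \<in> carrier G \<rightarrow> carrier R" by simp
  next
    let ?x = "\<lambda>g. free_gen K g :: 'g list \<Rightarrow> 'k"
    have rel: "f r = \<zero>\<^bsub>R\<^esub>" if "r \<in> twisted_relations K G \<sigma>" for r
      using \<open>?zero\<close> that by blast
    fix g h assume gh: "g \<in> carrier G" "h \<in> carrier G"
    {
      assume 0: "\<sigma> (g, h) = \<zero>"
      have "f (?x (inv\<^bsub>G\<^esub> g) \<otimes>\<^bsub>F\<^esub> ?x (g \<otimes>\<^bsub>G\<^esub> h)) = \<zero>\<^bsub>R\<^esub>"
        using gh 0 by (intro rel twisted_relationsI)
      then show "f (?x (inv\<^bsub>G\<^esub> g)) \<otimes>\<^bsub>R\<^esub> f (?x (g \<otimes>\<^bsub>G\<^esub> h)) = \<zero>\<^bsub>R\<^esub>"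
        using gh by simp
      have "f (?x (g \<otimes>\<^bsub>G\<^esub> h) \<otimes>\<^bsub>F\<^esub> ?x (inv\<^bsub>G\<^esub> h)) = \<zero>\<^bsub>R\<^esub>"
        using gh 0 by (intro rel twisted_relationsI)
      then show "f (?x (g \<otimes>\<^bsub>G\<^esub> h)) \<otimes>\<^bsub>R\<^esub> f (?x (inv\<^bsub>G\<^esub> h)) = \<zero>\<^bsub>R\<^esub>"
        using gh by simp
    }
    have "f ((?x (inv\<^bsub>G\<^esub> g) \<otimes>\<^bsub>F\<^esub> ?x g \<otimes>\<^bsub>F\<^esub> ?x h)
        \<ominus>\<^bsub>F\<^esub> (\<sigma> (g, h) \<odot>\<^bsub>F\<^esub> (?x (inv\<^bsub>G\<^esub> g) \<otimes>\<^bsub>F\<^esub> ?x (g \<otimes>\<^bsub>G\<^esub> h)))) = \<zero>\<^bsub>R\<^esub>"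
      using gh by (intro rel twisted_relationsI)
    then show "f (?x (inv\<^bsub>G\<^esub> g)) \<otimes>\<^bsub>R\<^esub> f (?x g) \<otimes>\<^bsub>R\<^esub> f (?x h)
        = \<sigma> (g, h) \<odot>\<^bsub>R\<^esub> (f (?x (inv\<^bsub>G\<^esub> g)) \<otimes>\<^bsub>R\<^esub> f (?x (g \<otimes>\<^bsub>G\<^esub> h)))"
      using gh by simp
    have "f ((?x g \<otimes>\<^bsub>F\<^esub> ?x h \<otimes>\<^bsub>F\<^esub> ?x (inv\<^bsub>G\<^esub> h))
        \<ominus>\<^bsub>F\<^esub> (\<sigma> (g, h) \<odot>\<^bsub>F\<^esub> (?x (g \<otimes>\<^bsub>G\<^esub> h) \<otimes>\<^bsub>F\<^esub> ?x (inv\<^bsub>G\<^esub> h)))) = \<zero>\<^bsub>R\<^esub>"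
      using gh by (intro rel twisted_relationsI)
    then show "f (?x g) \<otimes>\<^bsub>R\<^esub> f (?x h) \<otimes>\<^bsub>R\<^esub> f (?x (inv\<^bsub>G\<^esub> h))
        = \<sigma> (g, h) \<odot>\<^bsub>R\<^esub> (f (?x (g \<otimes>\<^bsub>G\<^esub> h)) \<otimes>\<^bsub>R\<^esub> f (?x (inv\<^bsub>G\<^esub> h)))"
      using gh by simp
  next
    have "f (free_gen K \<one>\<^bsub>G\<^esub> \<ominus>\<^bsub>F\<^esub> \<one>\<^bsub>F\<^esub>) = \<zero>\<^bsub>R\<^esub>"
      using \<open>?zero\<close> twisted_relationsI(5) by blast
    then show "f (free_gen K \<one>\<^bsub>G\<^esub>) = \<one>\<^bsub>R\<^esub>" by simp
  qed
  show ?zero if ?rep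
  proof -
    interpret \<Gamma>: partial_sigma_representation K G \<sigma> R "\<lambda>g. f (free_gen K g)" by fact
    show ?thesis
    proof
      fix r assume "r \<in> twisted_relations K G \<sigma>"
      then show "f r = \<zero>\<^bsub>R\<^esub>"
        unfolding twisted_relations_def Let_def
        by (elim UnE CollectE exE conjE singletonE)
          (simp_all add: \<Gamma>.rep_zero_left \<Gamma>.rep_zero_right \<Gamma>.rep_mult_left
            \<Gamma>.rep_mult_right \<Gamma>.rep_one)
    qed
  qed
qed

sublocale T: algebra_ideal K F I
  by (intro algebra_ideal.intro unital_algebra_free_algebra)
    (unfold twisted_ideal_def, rule F.A.genideal_ideal[OF twisted_relations_subset])

lemma T_eq: "T = quot_algebra F I"
  by (simp add: twisted_partial_group_algebra_def)

lemma twisted_relations_in_ideal: "twisted_relations K G \<sigma> \<subseteq> I"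
  unfolding twisted_ideal_def by (rule F.A.genideal_self[OF twisted_relations_subset])

lemma partial_sigma_representation_extends:
  assumes "partial_sigma_representation K G \<sigma> R \<Gamma>"
  shows "\<exists>\<phi>\<in>extensional (carrier T). unital_algebra_hom K T R \<phi> \<and>
    (\<forall>g\<in>carrier G. \<phi> (twisted_gen K G \<sigma> g) = \<Gamma> g)"
proof -
  interpret \<Gamma>: partial_sigma_representation K G \<sigma> R \<Gamma> by fact
  obtain f where f: "unital_algebra_hom K F R f"
    and f_gen: "\<And>g. g \<in> carrier G \<Longrightarrow> f (free_gen K g) = \<Gamma> g"
    using free_algebra_hom_exists[OF \<Gamma>.unital_algebra_axioms \<Gamma>.rep_closed] by blast
  interpret f: unital_algebra_hom K F R f by fact
  have "partial_sigma_representation K G \<sigma> R (\<lambda>g. f (free_gen K g))"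
    by (intro partial_sigma_representation.intro partial_sigma_representation_axioms.intro
        G.is_group \<Gamma>.unital_algebra_axioms twist_closed)
      (simp_all add: f_gen free_gen_mem \<Gamma>.rep_closed[THEN funcset_mem] \<Gamma>.rep_zero_left
        \<Gamma>.rep_zero_right \<Gamma>.rep_mult_left \<Gamma>.rep_mult_right \<Gamma>.rep_one)
  then have "\<And>r. r \<in> twisted_relations K G \<sigma> \<Longrightarrow> f r = \<zero>\<^bsub>R\<^esub>"
    using hom_zero_on_relations_iff[OF f] by blast
  then have "f p = \<zero>\<^bsub>R\<^esub>" if "p \<in> I" for p
    using f.hom_eq_zero_on_Idl[OF twisted_relations_subset] that by (simp add: twisted_ideal_def)
  then obtain \<phi> where "\<phi> \<in> extensional (carrier T)" "unital_algebra_hom K T R \<phi>"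
    and "\<And>p. p \<in> carrier F \<Longrightarrow> \<phi> (I +>\<^bsub>F\<^esub> p) = f p"
    using T.quot_algebra_hom_exists[OF f] unfolding T_eq by blast
  then show ?thesis
    by (intro bexI[of _ \<phi>]) (simp_all add: twisted_gen_def free_gen_mem f_gen)
qed

text \<open>
  The hypothesis encodes that the ideal is proper: otherwise the unit and zero of the quotient
  would coincide.
\<close>

lemma coset_hom_to_T:
  assumes "unital_algebra K T"
  shows "unital_algebra_hom K F T (\<lambda>p. I +>\<^bsub>F\<^esub> p)"
proof -
  interpret T': unital_algebra K T by fact
  have "\<one>\<^bsub>F\<^esub> \<notin> I"
    using T'.algebra_one_not_zero T.coset_eq_zero_iff[OF F.A.one_closed]
    by (simp add: T_eq T.coset_one)
  then show ?thesis unfolding T_eq by (rule T.coset_hom)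
qed

text \<open>
  Pulled back along the projection, both homomorphisms are defined on the free algebra and agree on
  its generators; every element of the quotient is a coset, hence in the image of the projection.
\<close>

lemma hom_from_T_unique:
  assumes "unital_algebra_hom K T R \<phi>" "unital_algebra_hom K T R \<psi>"
    and eq: "\<And>g. g \<in> carrier G \<Longrightarrow> \<phi> (twisted_gen K G \<sigma> g) = \<psi> (twisted_gen K G \<sigma> g)"
    and "C \<in> carrier T"
  shows "\<phi> C = \<psi> C"
proof -
  have \<pi>: "unital_algebra_hom K F T (\<lambda>p. I +>\<^bsub>F\<^esub> p)"
    using assms(1) by (intro coset_hom_to_T unital_algebra_hom.axioms(1))
  obtain p where p: "p \<in> carrier F" "C = I +>\<^bsub>F\<^esub> p"
    using \<open>C \<in> carrier T\<close> unfolding T_eq by (rule T.quot_carrierE)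
  show ?thesis
    unfolding p(2)
    by (rule free_algebra_hom_eqI[OF unital_algebra_hom_compose[OF \<pi> assms(1)]
          unital_algebra_hom_compose[OF \<pi> assms(2)] _ p(1)])
      (use eq in \<open>simp add: twisted_gen_def\<close>)
qed

lemma hom_from_T_is_partial_sigma_representation:
  assumes "unital_algebra_hom K T R \<phi>"
  shows "partial_sigma_representation K G \<sigma> R (\<lambda>g. \<phi> (twisted_gen K G \<sigma> g))"
proof -
  interpret \<phi>: unital_algebra_hom K T R \<phi> by fact
  have "unital_algebra_hom K F R (\<lambda>p. \<phi> (I +>\<^bsub>F\<^esub> p))"
    by (rule unital_algebra_hom_compose[OF coset_hom_to_T[OF \<phi>.dom.unital_algebra_axioms] assms])
  note iff = hom_zero_on_relations_iff[OF this]
  have "\<phi> (I +>\<^bsub>F\<^esub> r) = \<zero>\<^bsub>R\<^esub>" if "r \<in> twisted_relations K G \<sigma>" for r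
  proof -
    have "I +>\<^bsub>F\<^esub> r = \<zero>\<^bsub>T\<^esub>"
      using that twisted_relations_in_ideal twisted_relations_subset
      unfolding T_eq by (subst T.coset_eq_zero_iff) auto
    then show ?thesis by simp
  qed
  then show ?thesis using iff by (simp add: twisted_gen_def)
qed

end

theorem proposition2p11:
  fixes K :: "('k, 'c) ring_scheme"
    and G :: "('g, 'b) monoid_scheme"
    and \<sigma> :: "'g \<times> 'g \<Rightarrow> 'k"
    and R :: "('k, 'r, 'm) module_scheme"
  assumes "field K"
    and "group G"
    and "\<sigma> \<in> pm TYPE('s) K G"
    and "unital_algebra K R"
  shows "(\<forall>\<Gamma>. partial_sigma_representation K G \<sigma> R \<Gamma> \<longrightarrow>
            (\<exists>!\<phi>. \<phi> \<in> extensional (carrier (twisted_partial_group_algebra K G \<sigma>)) \<and>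
              unital_algebra_hom K (twisted_partial_group_algebra K G \<sigma>) R \<phi> \<and>
              (\<forall>g\<in>carrier G. \<phi> (twisted_gen K G \<sigma> g) = \<Gamma> g)))
       \<and> (\<forall>\<phi>. unital_algebra_hom K (twisted_partial_group_algebra K G \<sigma>) R \<phi> \<longrightarrow>
            (\<exists>\<Gamma>. partial_sigma_representation K G \<sigma> R \<Gamma> \<and>
              (\<forall>g\<in>carrier G. \<phi> (twisted_gen K G \<sigma> g) = \<Gamma> g)))"
proof (intro conjI allI impI)
  from \<open>\<sigma> \<in> pm TYPE('s) K G\<close>
  have "\<sigma> \<in> carrier G \<times> carrier G \<rightarrow> carrier K"
    unfolding pm_def is_factor_set_def
    by (blast dest: partial_sigma_representation.sigma_closed)
  then interpret twisted_presentation K G \<sigma>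
    using \<open>field K\<close> \<open>group G\<close>
    by (intro twisted_presentation.intro twisted_presentation_axioms.intro)
  {
    fix \<Gamma>
    assume \<Gamma>: "partial_sigma_representation K G \<sigma> R \<Gamma>"
    show "\<exists>!\<phi>. \<phi> \<in> extensional (carrier T) \<and> unital_algebra_hom K T R \<phi> \<and>
        (\<forall>g\<in>carrier G. \<phi> (twisted_gen K G \<sigma> g) = \<Gamma> g)"
      (is "\<exists>!\<phi>. ?P \<phi>")
    proof (rule ex_ex1I)
      show "\<exists>\<phi>. ?P \<phi>" using partial_sigma_representation_extends[OF \<Gamma>] by blast
    next
      fix \<phi> \<psi> assume "?P \<phi>" "?P \<psi>"
      then have hom: "unital_algebra_hom K T R \<phi>" "unital_algebra_hom K T R \<psi>"
        and ext: "\<phi> \<in> extensional (carrier T)" "\<psi> \<in> extensional (carrier T)"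
        and eq: "\<And>g. g \<in> carrier G \<Longrightarrow>
          \<phi> (twisted_gen K G \<sigma> g) = \<psi> (twisted_gen K G \<sigma> g)"
        by simp_all
      show "\<phi> = \<psi>"
        using ext hom_from_T_unique[OF hom eq] by (rule extensionalityI)
    qed
  next
    fix \<phi> assume "unital_algebra_hom K T R \<phi>"
    then show "\<exists>\<Gamma>. partial_sigma_representation K G \<sigma> R \<Gamma> \<and>
        (\<forall>g\<in>carrier G. \<phi> (twisted_gen K G \<sigma> g) = \<Gamma> g)"
      using hom_from_T_is_partial_sigma_representation by blast
  }
qed

end
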